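(* Let $T>0$ and $S\in\mathcal Z^n$. Assume that for all $t\in[0,T]$ there exist constants $c_1,c_2>0$ such that $v_t$ satisfies the linear growth condition $\|\nabla\log v_t(x)\|\le c_1\|x\|+c_2$ for all $x\in\mathbb R^d$. Then, for all $t\in[0,T]$, $$\Delta_{P,P_S}(v_t)\le\mathbb E_{Y\sim\rho_t^S}\left[\mathrm W_2(\delta_YP,\delta_YP_S)^2\right]^{1/2}\left(\frac{c_1}2\|P\|_t+\frac{c_1}2\|P_S\|_t+c_2\right),$$ where $\|P\|_t^2:=\mathbb E_{X\sim\rho_t^SP}[\|X\|^2]$ and $\|P_S\|_t^2:=\mathbb E_{X\sim\rho_t^SP_S}[\|X\|^2]$.
   Context: For a Markov kernel $K$ on $\mathbb R^d$: $Kf(x)=\int f(y)\,K(x,dy)$, $\mu K(A)=\int K(x,A)\,d\mu(x)$, and $\delta_xK=K(x,\cdot)$. $\mathrm W_2$ is the 2-Wasserstein distance, $\mathrm W_2(\mu,\nu)^2=\inf_{\gamma}\iint\|x-y\|^2d\gamma(x,y)$ over couplings $\gamma$ of $\mu$ and $\nu$ (which have second-order moments). For each $S\in\mathcal Z^n$ ($\mathcal Z$ a measurable space), $(X^S_k)_{k\in\mathbb N}$ is a time-homogeneous Markov chain on $\mathbb R^d$ with Markov kernel $P_S$ and initial law $\mu_0$. $(N_t)_{t\ge0}$ is a Poisson process of intensity $1$ independent of all other random variables; $Y^S_t:=X^S_{N_t}$ and $\rho_t^S$ is the law of $Y_t^S$ for fixed $S$. $P$ is a Markov kernel on $\mathbb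 R^d$ not depending on $S$, and $\pi$ is a Borel probability measure with $\pi P=\pi$; it is assumed that $\mu_0\ll\pi$. $v_t:=\frac{d\rho_t^S}{d\pi}$ (assumed to exist; under the linear growth hypothesis it is implicitly positive and differentiable). The expansion term is $\Delta_{P,P_S}(f):=\int f\,(P_S-P)(\log f)\,d\pi$ whenever it is defined. *)

theory Defs
  imports "HOL-Probability.Probability"
begin

definition markov_kernel :: "('a::euclidean_space \<Rightarrow> 'a measure) \<Rightarrow> bool" where
  "markov_kernel K \<longleftrightarrow> K \<in> borel \<rightarrow>\<^sub>M prob_algebra borel"

text \<open>The action \<open>K f\<close> of a kernel on functions. The action on measures is the Giry bind
  \<open>\<mu> \<bind> K\<close>, and the row \<open>\<delta>\<^sub>x K\<close> is \<open>K x\<close>.\<close>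

definition kernel_apply :: "('a \<Rightarrow> 'a measure) \<Rightarrow> ('a \<Rightarrow> real) \<Rightarrow> 'a \<Rightarrow> real" where
  "kernel_apply K f x = (\<integral>y. f y \<partial>K x)"

definition past_algebra :: "'w measure \<Rightarrow> (nat \<Rightarrow> 'w \<Rightarrow> 'a::euclidean_space) \<Rightarrow> nat \<Rightarrow> 'w measure" where
  "past_algebra M X k =
     vimage_algebra (space M) (\<lambda>\<omega>. \<lambda>i\<in>{..k}. X i \<omega>) (Pi\<^sub>M {..k} (\<lambda>_. borel))"

text \<open>Markov property: \<open>\<P>(X\<^sub>k\<^sub>+\<^sub>1 \<in> A | X\<^sub>0, \<dots>, X\<^sub>k) = K(X\<^sub>k, A)\<close> almost surely.\<close>

definition markov_chain ::
  "'w measure \<Rightarrow> ('a::euclidean_space \<Rightarrow> 'a measure) \<Rightarrow> 'a measure \<Rightarrow> (nat \<Rightarrow> 'w \<Rightarrow> 'a) \<Rightarrow> bool" where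
  "markov_chain M K \<mu> X \<longleftrightarrow>
     (\<forall>k. X k \<in> borel_measurable M) \<and>
     distr M borel (X 0) = \<mu> \<and>
     (\<forall>k. \<forall>A\<in>sets borel. AE \<omega> in M.
        real_cond_exp M (past_algebra M X k) (\<lambda>\<omega>'. indicator A (X (Suc k) \<omega>')) \<omega>
          = measure (K (X k \<omega>)) A)"

text \<open>Increments are truncated subtractions of naturals; this is harmless since almost every path
  is nondecreasing. Independence is stated along infinite increasing sequences of times, which is
  equivalent to independence along finite ones.\<close>

definition poisson_process :: "'w measure \<Rightarrow> real \<Rightarrow> (real \<Rightarrow> 'w \<Rightarrow> nat) \<Rightarrow> bool" where
  "poisson_process M rate N \<longleftrightarrow>
     (\<forall>t\<ge>0. N t \<in> M \<rightarrow>\<^sub>M count_space UNIV) \<and>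
     (AE \<omega> in M. N 0 \<omega> = 0 \<and> mono_on {0..} (\<lambda>t. N t \<omega>) \<and>
        (\<forall>t\<ge>0. continuous (at_right t) (\<lambda>s. N s \<omega>))) \<and>
     (\<forall>s t. 0 \<le> s \<longrightarrow> s < t \<longrightarrow>
        distr M (count_space UNIV) (\<lambda>\<omega>. N t \<omega> - N s \<omega>)
          = measure_pmf (poisson_pmf (rate * (t - s)))) \<and>
     (\<forall>\<tau>. 0 \<le> \<tau> 0 \<longrightarrow> strict_mono \<tau> \<longrightarrow>
        prob_space.indep_vars M (\<lambda>_. count_space UNIV)
          (\<lambda>i \<omega>. N (\<tau> (Suc i)) \<omega> - N (\<tau> i) \<omega>) (UNIV :: nat set))"

definition indep_processes ::
  "'w measure \<Rightarrow> (nat \<Rightarrow> 'w \<Rightarrow> 'a::euclidean_space) \<Rightarrow> (real \<Rightarrow> 'w \<Rightarrow> nat) \<Rightarrow> bool" where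
  "indep_processes M X N \<longleftrightarrow>
     prob_space.indep_set M
       (sets (vimage_algebra (space M) (\<lambda>\<omega> k. X k \<omega>) (Pi\<^sub>M UNIV (\<lambda>_. borel))))
       (sets (vimage_algebra (space M) (\<lambda>\<omega>. \<lambda>t\<in>{0..}. N t \<omega>)
          (Pi\<^sub>M {0..} (\<lambda>_. count_space UNIV))))"

definition subordinated :: "(nat \<Rightarrow> 'w \<Rightarrow> 'a) \<Rightarrow> (real \<Rightarrow> 'w \<Rightarrow> nat) \<Rightarrow> real \<Rightarrow> 'w \<Rightarrow> 'a" where
  "subordinated X N t \<omega> = X (N t \<omega>) \<omega>"

definition ennreal_sqrt :: "ennreal \<Rightarrow> ennreal" where
  "ennreal_sqrt x = (if x = \<infinity> then \<infinity> else ennreal (sqrt (enn2real x)))"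

definition couplings ::
  "'a::euclidean_space measure \<Rightarrow> 'a measure \<Rightarrow> ('a \<times> 'a) measure set" where
  "couplings \<mu> \<nu> =
     {\<gamma>. sets \<gamma> = sets (borel \<Otimes>\<^sub>M borel) \<and> distr \<gamma> borel fst = \<mu> \<and> distr \<gamma> borel snd = \<nu>}"

text \<open>Defined for all Borel probability measures; it may take the value \<open>\<infinity>\<close> if second moments
  are infinite.\<close>

definition W2 :: "'a::euclidean_space measure \<Rightarrow> 'a measure \<Rightarrow> ennreal" where
  "W2 \<mu> \<nu> = ennreal_sqrt (INF \<gamma>\<in>couplings \<mu> \<nu>. \<integral>\<^sup>+ (x, y). ennreal ((norm (x - y))\<^sup>2) \<partial>\<gamma>)"

definition l2_norm :: "'a::euclidean_space measure \<Rightarrow> ennreal" where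
  "l2_norm \<mu> = ennreal_sqrt (\<integral>\<^sup>+ x. ennreal ((norm x)\<^sup>2) \<partial>\<mu>)"

definition gradient :: "('a::euclidean_space \<Rightarrow> real) \<Rightarrow> 'a \<Rightarrow> 'a" where
  "gradient f x = (THE D. GDERIV f x :> D)"

text \<open>Positivity and differentiability make \<open>gradient (\<lambda>y. ln (v y)) x\<close> a genuine gradient.\<close>

definition linear_growth :: "real \<Rightarrow> real \<Rightarrow> ('a::euclidean_space \<Rightarrow> real) \<Rightarrow> bool" where
  "linear_growth c1 c2 v \<longleftrightarrow>
     (\<forall>x. 0 < v x \<and> v differentiable (at x) \<and>
          norm (gradient (\<lambda>y. ln (v y)) x) \<le> c1 * norm x + c2)"

definition expansion_term ::
  "'a::euclidean_space measure \<Rightarrow> ('a \<Rightarrow> 'a measure) \<Rightarrow> ('a \<Rightarrow> 'a measure) \<Rightarrow> ('a \<Rightarrow> real) \<Rightarrow> real" where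
  "expansion_term \<pi> P Q f =
     (\<integral>x. f x * (kernel_apply Q (\<lambda>y. ln (f y)) x - kernel_apply P (\<lambda>y. ln (f y)) x) \<partial>\<pi>)"

definition expansion_term_defined ::
  "'a::euclidean_space measure \<Rightarrow> ('a \<Rightarrow> 'a measure) \<Rightarrow> ('a \<Rightarrow> 'a measure) \<Rightarrow> ('a \<Rightarrow> real) \<Rightarrow> bool" where
  "expansion_term_defined \<pi> P Q f \<longleftrightarrow>
     (AE x in \<pi>. integrable (P x) (\<lambda>y. ln (f y)) \<and> integrable (Q x) (\<lambda>y. ln (f y))) \<and>
     integrable \<pi> (\<lambda>x. f x * (kernel_apply Q (\<lambda>y. ln (f y)) x - kernel_apply P (\<lambda>y. ln (f y)) x))"

end

theory Submission
  imports Defs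
begin

text \<open>The linear growth of the gradient makes \<open>f = log v\<^sub>t\<close> satisfy
  \<open>\<bar>f a - f b\<bar> \<le> \<parallel>a - b\<parallel> (c\<^sub>1\<parallel>a\<parallel>/2 + c\<^sub>1\<parallel>b\<parallel>/2 + c\<^sub>2)\<close>, by integrating along the segment. Integrating
  this against a coupling of \<open>P x\<close> and \<open>P\<^sub>S x\<close> and applying Cauchy--Schwarz bounds
  \<open>\<bar>P\<^sub>S f x - P f x\<bar>\<close> by \<open>W\<^sub>2(P x, P\<^sub>S x) D x\<close> with \<open>D x\<close> made of second moments; a second
  Cauchy--Schwarz under \<open>\<rho>\<^sub>t\<close> concludes. The measurability of \<open>x \<mapsto> W\<^sub>2(P x, P\<^sub>S x)\<close> is never needed,
  because the measurable function \<open>\<bar>P\<^sub>S f - P f\<bar> / D\<close> lies below it.\<close>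

section \<open>Square roots in \<open>ennreal\<close> and the Cauchy-Schwarz inequality\<close>

lemma ennreal_sqrt_power2 [simp]: "(ennreal_sqrt x)\<^sup>2 = x"
  by (cases x) (auto simp: ennreal_sqrt_def ennreal_power)

lemma power2_le_iff_ennreal: "x\<^sup>2 \<le> y\<^sup>2 \<longleftrightarrow> x \<le> (y::ennreal)"
proof
  assume *: "x\<^sup>2 \<le> y\<^sup>2"
  show "x \<le> y"
  proof (cases x; cases y)
    fix r s assume rs: "x = ennreal r" "0 \<le> r" "y = ennreal s" "0 \<le> s"
    with * have "r\<^sup>2 \<le> s\<^sup>2" by (simp add: ennreal_power)
    then have "r \<le> s" using \<open>0 \<le> s\<close> by (rule power2_le_imp_le)
    with rs show ?thesis by (simp add: ennreal_leI)
  qed (use * in \<open>auto simp: ennreal_power top_unique\<close>)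
qed (rule power_mono_ennreal)

lemma ennreal_sqrt_le_iff: "ennreal_sqrt x \<le> y \<longleftrightarrow> x \<le> y\<^sup>2"
  using power2_le_iff_ennreal[of "ennreal_sqrt x" y] by simp

lemma le_ennreal_sqrt_iff: "x \<le> ennreal_sqrt y \<longleftrightarrow> x\<^sup>2 \<le> y"
  using power2_le_iff_ennreal[of x "ennreal_sqrt y"] by simp

lemma ennreal_sqrt_mono: "x \<le> y \<Longrightarrow> ennreal_sqrt x \<le> ennreal_sqrt y"
  by (simp add: ennreal_sqrt_le_iff)

lemma ennreal_sqrt_eq_0_iff [simp]: "ennreal_sqrt x = 0 \<longleftrightarrow> x = 0"
  using ennreal_sqrt_le_iff[of x 0] by simp

lemma ennreal_sqrt_eq_top_iff [simp]: "ennreal_sqrt x = \<top> \<longleftrightarrow> x = \<top>"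
  by (auto simp: ennreal_sqrt_def)

lemma ennreal_sqrt_measurable [measurable]:
  assumes [measurable]: "f \<in> borel_measurable M"
  shows "(\<lambda>x. ennreal_sqrt (f x)) \<in> borel_measurable M"
  unfolding ennreal_sqrt_def by measurable

lemma Cauchy_Schwarz_ennreal_sqrt:
  assumes [measurable]: "f \<in> borel_measurable M" "g \<in> borel_measurable M"
  shows "(\<integral>\<^sup>+x. f x * g x \<partial>M) \<le> ennreal_sqrt (\<integral>\<^sup>+x. (f x)\<^sup>2 \<partial>M) * ennreal_sqrt (\<integral>\<^sup>+x. (g x)\<^sup>2 \<partial>M)"
  using Cauchy_Schwarz_nn_integral[OF assms]
  by (subst power2_le_iff_ennreal[symmetric]) (simp add: power_mult_distrib)

text \<open>The form of Cauchy-Schwarz used twice, under a coupling and under \<open>\<rho>\<close>.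
  The constant \<open>c\<close> is paired with the function 1, whose \<open>L2\<close> norm is 1
  because \<open>M\<close> is a probability space.\<close>

lemma Cauchy_Schwarz_affine:
  fixes k c :: ennreal
  assumes "prob_space M"
    and [measurable]: "p \<in> borel_measurable M" "a \<in> borel_measurable M" "b \<in> borel_measurable M"
  shows "(\<integral>\<^sup>+x. p x * (k * a x + k * b x + c) \<partial>M) \<le>
    ennreal_sqrt (\<integral>\<^sup>+x. (p x)\<^sup>2 \<partial>M) *
      (k * ennreal_sqrt (\<integral>\<^sup>+x. (a x)\<^sup>2 \<partial>M) + k * ennreal_sqrt (\<integral>\<^sup>+x. (b x)\<^sup>2 \<partial>M) + c)"
proof -
  interpret prob_space M by fact
  let ?p = "ennreal_sqrt (\<integral>\<^sup>+x. (p x)\<^sup>2 \<partial>M)"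
  have one: "(\<integral>\<^sup>+x. p x \<partial>M) \<le> ?p"
    using Cauchy_Schwarz_ennreal_sqrt[of p M "\<lambda>_. 1"]
    by (simp add: emeasure_space_1 ennreal_sqrt_def)
  have "(\<integral>\<^sup>+x. p x * (k * a x + k * b x + c) \<partial>M) =
      (\<integral>\<^sup>+x. k * (p x * a x) + k * (p x * b x) + c * p x \<partial>M)"
    by (intro nn_integral_cong) (simp only: distrib_left ac_simps)
  also have "\<dots> = k * (\<integral>\<^sup>+x. p x * a x \<partial>M) + k * (\<integral>\<^sup>+x. p x * b x \<partial>M) + c * (\<integral>\<^sup>+x. p x \<partial>M)"
    by (simp add: nn_integral_add nn_integral_cmult)
  also have "\<dots> \<le> k * (?p * ennreal_sqrt (\<integral>\<^sup>+x. (a x)\<^sup>2 \<partial>M)) +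
      k * (?p * ennreal_sqrt (\<integral>\<^sup>+x. (b x)\<^sup>2 \<partial>M)) + c * ?p"
    by (intro add_mono mult_left_mono Cauchy_Schwarz_ennreal_sqrt one) auto
  finally show ?thesis by (simp only: distrib_left ac_simps)
qed

section \<open>Lower bounds for the Wasserstein distance\<close>

lemma W2_greatest:
  assumes "\<And>\<gamma>. \<gamma> \<in> couplings \<mu> \<nu> \<Longrightarrow> r\<^sup>2 \<le> (\<integral>\<^sup>+(x, y). ennreal ((norm (x - y))\<^sup>2) \<partial>\<gamma>)"
  shows "r \<le> W2 \<mu> \<nu>"
  unfolding W2_def le_ennreal_sqrt_iff by (intro INF_greatest assms)

text \<open>Dividing by the \<open>L\<^sup>2\<close> factor, rather than multiplying \<^const>\<open>W2\<close> by it, keeps the bound true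
  when that factor is infinite.\<close>

lemma integral_diff_le_W2:
  fixes f :: "'a::euclidean_space \<Rightarrow> real"
  assumes \<mu>: "prob_space \<mu>" "sets \<mu> = sets borel" and \<nu>: "prob_space \<nu>" "sets \<nu> = sets borel"
    and int: "integrable \<mu> f" "integrable \<nu> f" and k: "0 \<le> k" and c: "0 < c"
    and f: "\<And>a b. \<bar>f a - f b\<bar> \<le> norm (a - b) * (k * norm a + k * norm b + c)"
  shows "ennreal \<bar>(\<integral>x. f x \<partial>\<mu>) - (\<integral>x. f x \<partial>\<nu>)\<bar> /
    (ennreal k * l2_norm \<mu> + ennreal k * l2_norm \<nu> + ennreal c) \<le> W2 \<mu> \<nu>"
    (is "?h / ?D \<le> _")
proof (rule W2_greatest)
  fix \<gamma> assume "\<gamma> \<in> couplings \<mu> \<nu>"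
  then have sets [measurable_cong]: "sets \<gamma> = sets (borel \<Otimes>\<^sub>M borel)"
    and fst: "distr \<gamma> borel fst = \<mu>" and snd: "distr \<gamma> borel snd = \<nu>"
    by (auto simp: couplings_def)
  have [measurable]: "f \<in> borel_measurable borel"
    using borel_measurable_integrable[OF int(1)] measurable_cong_sets[OF \<mu>(2) refl] by auto
  \<comment> \<open>The definition of \<open>couplings\<close> does not ask for mass 1; it is
    inherited from the first marginal.\<close>
  have prob: "prob_space \<gamma>"
    using prob_space_distrD[of fst \<gamma> borel] \<mu>(1) fst by simp
  let ?I = "\<integral>\<^sup>+(x, y). ennreal ((norm (x - y))\<^sup>2) \<partial>\<gamma>"
  have int1: "integrable \<gamma> (\<lambda>z. f (fst z))" "integrable \<gamma> (\<lambda>z. f (snd z))"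
    using int unfolding fst[symmetric] snd[symmetric] by (simp_all add: integrable_distr_eq)
  have "(\<integral>x. f x \<partial>\<mu>) - (\<integral>x. f x \<partial>\<nu>) = (\<integral>z. f (fst z) - f (snd z) \<partial>\<gamma>)"
    unfolding fst[symmetric] snd[symmetric] using int1 by (simp add: integral_distr)
  then have "?h \<le> (\<integral>\<^sup>+z. ennreal \<bar>f (fst z) - f (snd z)\<bar> \<partial>\<gamma>)"
    using integral_norm_bound_ennreal[of \<gamma> "\<lambda>z. f (fst z) - f (snd z)"] int1 by simp
  also have "\<dots> \<le> (\<integral>\<^sup>+z. ennreal (norm (fst z - snd z)) *
      (ennreal k * ennreal (norm (fst z)) + ennreal k * ennreal (norm (snd z)) + ennreal c) \<partial>\<gamma>)"
  proof (intro nn_integral_mono)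
    fix z :: "'a \<times> 'a"
    show "ennreal \<bar>f (fst z) - f (snd z)\<bar> \<le> ennreal (norm (fst z - snd z)) *
      (ennreal k * ennreal (norm (fst z)) + ennreal k * ennreal (norm (snd z)) + ennreal c)"
      using k c f[of "fst z" "snd z"]
      by (simp flip: ennreal_mult ennreal_plus add: ennreal_leI)
  qed
  also have "\<dots> \<le> ennreal_sqrt (\<integral>\<^sup>+z. (ennreal (norm (fst z - snd z)))\<^sup>2 \<partial>\<gamma>) *
      (ennreal k * ennreal_sqrt (\<integral>\<^sup>+z. (ennreal (norm (fst z)))\<^sup>2 \<partial>\<gamma>) +
       ennreal k * ennreal_sqrt (\<integral>\<^sup>+z. (ennreal (norm (snd z)))\<^sup>2 \<partial>\<gamma>) + ennreal c)"
    by (intro Cauchy_Schwarz_affine prob) simp_all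
  also have "\<dots> = ennreal_sqrt ?I * ?D"
    unfolding fst[symmetric] snd[symmetric] l2_norm_def
    by (simp add: nn_integral_distr ennreal_power case_prod_beta')
  finally have *: "?h \<le> ennreal_sqrt ?I * ?D" .
  have "?h / ?D \<le> ennreal_sqrt ?I"
  proof (cases "?D = \<top>")
    case False
    moreover have "?D \<noteq> 0" using c by simp
    ultimately show ?thesis
      using divide_right_mono_ennreal[OF *, of ?D]
      by (simp add: ennreal_mult_divide_eq)
  next
    case True
    then show ?thesis by (simp only: ennreal_divide_top zero_le)
  qed
  then show "(?h / ?D)\<^sup>2 \<le> ?I"
    by (simp add: le_ennreal_sqrt_iff)
qed

section \<open>Quadratic growth and linear growth of the gradient\<close>

text \<open>Comparing \<open>f x\<close> with \<open>f 0\<close> leaves only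
  \<open>k * (norm x)\<^sup>2 + c * norm x\<close>, and a finite second moment controls both
  terms.\<close>

lemma integrable_quadratic_growth:
  fixes f :: "'a::euclidean_space \<Rightarrow> real"
  assumes "prob_space \<mu>" and sets [measurable_cong]: "sets \<mu> = sets borel" and "l2_norm \<mu> < \<infinity>"
    and [measurable]: "f \<in> borel_measurable borel"
    and "0 \<le> k" "0 \<le> c"
    and f: "\<And>a b. \<bar>f a - f b\<bar> \<le> norm (a - b) * (k * norm a + k * norm b + c)"
  shows "integrable \<mu> f"
proof -
  interpret prob_space \<mu> by fact
  have "integrable \<mu> (\<lambda>x. (norm x)\<^sup>2)"
    using assms(3) unfolding l2_norm_def
    by (intro integrableI_bounded) (auto simp: less_top[symmetric] )
  then have "integrable \<mu> (\<lambda>x. \<bar>f 0\<bar> + c + (k + c) * (norm x)\<^sup>2)"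
    by simp
  then show ?thesis
  proof (rule Bochner_Integration.integrable_bound)
    have "\<bar>f x\<bar> \<le> \<bar>f 0\<bar> + c + (k + c) * (norm x)\<^sup>2" for x
    proof -
      \<comment> \<open>From \<open>2 * norm x \<le> 1 + (norm x)\<^sup>2\<close>, since
        \<open>norm x\<close> is nonnegative.\<close>
      have "norm x \<le> 1 + (norm x)\<^sup>2"
        using sum_squares_bound[of 1 "norm x"] norm_ge_zero[of x] unfolding one_power2 by linarith
      then have "c * norm x \<le> c * (1 + (norm x)\<^sup>2)" by (rule mult_left_mono) fact
      with f[of x 0] show ?thesis by (simp add: algebra_simps power2_eq_square)
    qed
    then show "AE x in \<mu>. norm (f x) \<le> norm (\<bar>f 0\<bar> + c + (k + c) * (norm x)\<^sup>2)"
      by (intro AE_I2) (metis real_norm_def abs_ge_self order_trans)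
  qed simp
qed

text \<open>\<open>gradient\<close> is a definite description, so existence and uniqueness are both
  due. The Riesz vector \<open>D\<close> of the derivative provides existence; uniqueness of
  derivatives does the rest.\<close>

lemma GDERIV_gradient:
  fixes f :: "'a::euclidean_space \<Rightarrow> real"
  assumes "f differentiable (at x)"
  shows "GDERIV f x :> gradient f x"
proof -
  obtain f' where f': "(f has_derivative f') (at x)"
    using assms by (auto simp: differentiable_def)
  then interpret linear f' by (rule has_derivative_linear)
  define D where "D = (\<Sum>b\<in>Basis. f' b *\<^sub>R b)"
  have "f' h = inner h D" for h
  proof -
    have "f' h = f' (\<Sum>b\<in>Basis. inner h b *\<^sub>R b)" by (simp add: euclidean_representation)
    then show ?thesis by (simp add: sum scale D_def inner_sum_right mult.commute)
  qed
  then have "f' = (\<lambda>h. inner h D)" by (rule ext)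
  with f' have D: "GDERIV f x :> D" by (simp add: gderiv_def)
  moreover have "E = D" if "GDERIV f x :> E" for E
    using has_derivative_unique[OF that[unfolded gderiv_def] D[unfolded gderiv_def]]
    by (metis inner_commute vector_eq_ldot)
  ultimately show ?thesis
    unfolding gradient_def by (rule theI)
qed

text \<open>Along the segment, \<open>\<psi>\<close> is a primitive of the bound on the directional derivative.\<close>

lemma gradient_growth_imp_increment_le:
  fixes f :: "'a::euclidean_space \<Rightarrow> real"
  assumes diff: "\<And>x. f differentiable (at x)"
    and growth: "\<And>x. norm (gradient f x) \<le> c1 * norm x + c2" and "0 \<le> c1"
  shows "\<bar>f a - f b\<bar> \<le> norm (a - b) * (c1 / 2 * norm a + c1 / 2 * norm b + c2)"
proof -
  \<comment> \<open>The one-sided bound suffices: its right-hand side is symmetric in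
    \<open>a\<close> and \<open>b\<close>, so swapping them gives the absolute value.\<close>
  have main: "f b - f a \<le> norm (b - a) * (c1 / 2 * norm a + c1 / 2 * norm b + c2)" for a b
  proof -
    define \<gamma> where "\<gamma> s = a + s *\<^sub>R (b - a)" for s :: real
    define \<psi> where "\<psi> s = norm (b - a) * (c1 * (s - s\<^sup>2 / 2) * norm a + c1 * (s\<^sup>2 / 2) * norm b + c2 * s)"
      for s :: real
    have f\<gamma>: "((\<lambda>s. f (\<gamma> s)) has_real_derivative inner (b - a) (gradient f (\<gamma> s))) (at s)" for s
    proof -
      have "(\<gamma> has_derivative (\<lambda>h. h *\<^sub>R (b - a))) (at s)"
        unfolding \<gamma>_def by (auto intro!: derivative_eq_intros)
      from has_derivative_compose[OF this GDERIV_gradient[OF diff, unfolded gderiv_def]]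
      show ?thesis
        by (simp add: has_field_derivative_def mult_commute_abs)
    qed
    have \<psi>: "(\<psi> has_real_derivative norm (b - a) * (c1 * (1 - s) * norm a + c1 * s * norm b + c2)) (at s)"
      for s unfolding \<psi>_def by (auto intro!: derivative_eq_intros)
    \<comment> \<open>The halves in the claim are the integrals of \<open>1 - s\<close> and
      \<open>s\<close> over the unit interval: \<open>\<psi> 0\<close> is 0 and
      \<open>\<psi> 1\<close> is the asserted bound.\<close>
    have "f (\<gamma> 1) - \<psi> 1 \<le> f (\<gamma> 0) - \<psi> 0"
    proof (rule DERIV_nonpos_imp_nonincreasing[where f = "\<lambda>s. f (\<gamma> s) - \<psi> s"])
      fix s :: real assume s: "0 \<le> s" "s \<le> 1"
      have "inner (b - a) (gradient f (\<gamma> s)) \<le> norm (b - a) * norm (gradient f (\<gamma> s))"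
        by (rule norm_cauchy_schwarz)
      also have "\<dots> \<le> norm (b - a) * (c1 * norm (\<gamma> s) + c2)"
        by (intro mult_left_mono growth) simp
      also have "\<dots> \<le> norm (b - a) * (c1 * ((1 - s) * norm a + s * norm b) + c2)"
      proof -
        have "\<gamma> s = (1 - s) *\<^sub>R a + s *\<^sub>R b" by (simp add: \<gamma>_def algebra_simps)
        then have "norm (\<gamma> s) \<le> (1 - s) * norm a + s * norm b"
          using norm_triangle_ineq[of "(1 - s) *\<^sub>R a" "s *\<^sub>R b"] s by simp
        then show ?thesis using \<open>0 \<le> c1\<close> by (intro mult_left_mono add_right_mono) auto
      qed
      finally show "\<exists>y. ((\<lambda>s. f (\<gamma> s) - \<psi> s) has_real_derivative y) (at s) \<and> y \<le> 0"
        using DERIV_diff[OF f\<gamma> \<psi>, of s] by (auto simp: algebra_simps)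
    qed simp
    then show ?thesis by (simp add: \<gamma>_def \<psi>_def algebra_simps)
  qed
  from main[of a b] main[of b a] show ?thesis
    by (simp add: norm_minus_commute algebra_simps abs_le_iff)
qed

section \<open>Testing equality of measures with Lipschitz bumps\<close>

lemma ex_countable_Int_stable_open_generator:
  obtains \<U> :: "'a::second_countable_topology set set"
  where "countable \<U>" "Int_stable \<U>" "UNIV \<in> \<U>" "\<And>U. U \<in> \<U> \<Longrightarrow> open U"
    "sets borel = sigma_sets UNIV \<U>"
proof -
  obtain B :: "'a set set" where B: "countable B" "topological_basis B"
    using ex_countable_basis by blast
  define \<U> where "\<U> = Inter ` {F. finite F \<and> F \<subseteq> B}"
  have "countable \<U>"
    unfolding \<U>_def by (intro countable_image countable_Collect_finite_subset B)
  moreover have "Int_stable \<U>"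
  proof (rule Int_stableI)
    fix U V assume "U \<in> \<U>" "V \<in> \<U>"
    then obtain F G where "finite F" "F \<subseteq> B" "U = \<Inter>F" "finite G" "G \<subseteq> B" "V = \<Inter>G"
      by (auto simp: \<U>_def)
    then show "U \<inter> V \<in> \<U>"
      unfolding \<U>_def by (intro image_eqI[of _ _ "F \<union> G"]) auto
  qed
  moreover have "UNIV \<in> \<U>"
    unfolding \<U>_def by (intro image_eqI[of _ _ "{}"]) auto
  moreover have op: "open U" if "U \<in> \<U>" for U
    using that topological_basis_open[OF B(2)] by (auto simp: \<U>_def intro!: open_Inter)
  moreover have "topological_basis \<U>"
  proof (rule topological_basisI)
    fix S :: "'a set" and x assume "open S" "x \<in> S"
    then obtain b where "b \<in> B" "x \<in> b" "b \<subseteq> S"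
      by (rule topological_basisE[OF B(2)])
    moreover have "b \<in> \<U>"
      unfolding \<U>_def using \<open>b \<in> B\<close> by (intro image_eqI[of _ _ "{b}"]) auto
    ultimately show "\<exists>U\<in>\<U>. x \<in> U \<and> U \<subseteq> S" by blast
  qed (rule op)
  then have "sets borel = sigma_sets UNIV \<U>"
    using borel_eq_countable_basis[OF \<open>countable \<U>\<close>] by (metis Pow_UNIV sets_measure_of top_greatest)
  ultimately show thesis by (rule that)
qed

text \<open>Approximates the indicator of an open set from below by Lipschitz functions, to which
  \<open>integral_diff_le_W2\<close> applies; the indicator itself would not qualify.\<close>

definition bump :: "'a::metric_space set \<Rightarrow> nat \<Rightarrow> 'a \<Rightarrow> real" where
  "bump U n x = min 1 (real n * infdist x (- U))"

lemma bump_nonneg: "0 \<le> bump U n x" and bump_le_1: "bump U n x \<le> 1"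
  by (auto simp: bump_def infdist_nonneg)

lemma bump_measurable [measurable]:
  "bump U n \<in> borel_measurable (borel :: 'a::metric_space measure)"
  unfolding bump_def by (intro borel_measurable_continuous_onI continuous_intros)

lemma bump_Lipschitz: "\<bar>bump U n x - bump U n y\<bar> \<le> real n * dist x y"
proof -
  have "\<bar>bump U n x - bump U n y\<bar> \<le> \<bar>real n * infdist x (- U) - real n * infdist y (- U)\<bar>"
    by (simp add: bump_def min_def abs_if)
  also have "\<dots> = real n * \<bar>infdist x (- U) - infdist y (- U)\<bar>"
    by (simp add: abs_mult flip: right_diff_distrib)
  also have "\<dots> \<le> real n * dist x y"
    by (intro mult_left_mono infdist_triangle_abs) simp
  finally show ?thesis .
qed

text \<open>The whole space is excluded because \<^term>\<open>infdist x {} = 0\<close>.\<close>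

lemma bump_tendsto_indicator:
  assumes "open U" "U \<noteq> UNIV"
  shows "(\<lambda>n. bump U n x) \<longlonglongrightarrow> indicator U x"
proof (cases "x \<in> U")
  case True
  have ne: "- U \<noteq> {}" and "closed (- U)" using assms by auto
  have "infdist x (- U) \<noteq> 0"
    using in_closed_iff_infdist_zero[OF \<open>closed (- U)\<close> ne, of x] True by simp
  then have pos: "0 < infdist x (- U)" using infdist_nonneg[of x "- U"] by linarith
  \<comment> \<open>From this index on the cap 1 is reached, so the sequence is eventually
    constant.\<close>
  obtain m :: nat where m: "1 < real m * infdist x (- U)"
    using reals_Archimedean3[OF pos] by auto
  have "bump U n x = 1" if "m \<le> n" for n
  proof -
    have "real m * infdist x (- U) \<le> real n * infdist x (- U)"
      using that pos by (intro mult_right_mono) auto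
    with m show ?thesis by (simp add: bump_def)
  qed
  then have "eventually (\<lambda>n. bump U n x = 1) sequentially"
    by (auto simp: eventually_sequentially)
  then show ?thesis using True by (auto intro: tendsto_eventually)
qed (simp add: bump_def)

lemma integrable_bump:
  assumes "finite_measure \<mu>" "sets \<mu> = sets borel"
  shows "integrable \<mu> (bump U n)"
proof -
  interpret finite_measure \<mu> by fact
  have [measurable]: "bump U n \<in> borel_measurable \<mu>"
    using assms(2) by (simp add: measurable_cong_sets[OF assms(2) refl])
  show ?thesis
    by (rule integrable_const_bound[of _ 1]) (auto simp: bump_nonneg bump_le_1)
qed

text \<open>Dominated convergence turns equal bump integrals into equal measures of the sets in
  \<open>\<U>\<close>; the pi-system uniqueness theorem extends this to all Borel sets.\<close>

lemma measure_eqI_bump: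
  fixes \<mu> \<nu> :: "'a::{metric_space, second_countable_topology} measure"
  assumes \<mu>: "prob_space \<mu>" "sets \<mu> = sets borel" and \<nu>: "prob_space \<nu>" "sets \<nu> = sets borel"
    and \<U>: "Int_stable \<U>" "UNIV \<in> \<U>" "\<And>U. U \<in> \<U> \<Longrightarrow> open U" "sets borel = sigma_sets UNIV \<U>"
    and eq: "\<And>U n. U \<in> \<U> \<Longrightarrow> (\<integral>x. bump U n x \<partial>\<mu>) = (\<integral>x. bump U n x \<partial>\<nu>)"
  shows "\<mu> = \<nu>"
proof -
  interpret \<mu>: prob_space \<mu> by fact
  interpret \<nu>: prob_space \<nu> by fact
  have lim: "(\<lambda>n. \<integral>x. bump U n x \<partial>\<kappa>) \<longlonglongrightarrow> measure \<kappa> U"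
    if U: "open U" "U \<noteq> UNIV" and \<kappa>: "prob_space \<kappa>" "sets \<kappa> = sets borel"
    for U and \<kappa> :: "'a measure"
  proof -
    interpret \<kappa>: prob_space \<kappa> by fact
    note [measurable_cong] = \<kappa>(2)
    have [measurable]: "U \<in> sets borel" using U by simp
    have "(\<lambda>n. \<integral>x. bump U n x \<partial>\<kappa>) \<longlonglongrightarrow> (\<integral>x. indicator U x \<partial>\<kappa>)"
      by (rule integral_dominated_convergence[where w = "\<lambda>_. 1"])
        (auto simp: bump_nonneg bump_le_1 U intro!: bump_tendsto_indicator)
    moreover have "space \<kappa> = UNIV" using sets_eq_imp_space_eq[OF \<kappa>(2)] by simp
    ultimately show ?thesis by simp
  qed
  have "emeasure \<mu> U = emeasure \<nu> U" if "U \<in> \<U>" for U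
  \<comment> \<open>The bumps of the whole space vanish identically and carry no information; there
    the total mass 1 is compared instead.\<close>
  proof (cases "U = UNIV")
    case True
    moreover have "space \<mu> = UNIV" "space \<nu> = UNIV"
      using \<mu>(2) \<nu>(2) by (auto dest: sets_eq_imp_space_eq)
    ultimately show ?thesis
      using \<mu>.emeasure_space_1 \<nu>.emeasure_space_1 by simp
  next
    case False
    have "measure \<mu> U = measure \<nu> U"
      using LIMSEQ_unique[OF lim[OF \<U>(3)[OF that] False \<mu>]] lim[OF \<U>(3)[OF that] False \<nu>] eq[OF that]
      by simp
    then show ?thesis by (simp add: \<mu>.emeasure_eq_measure \<nu>.emeasure_eq_measure)
  qed
  then show ?thesis
    by (intro measure_eqI_generator_eq[of \<U> UNIV \<mu> \<nu> "\<lambda>_. UNIV"]) (use \<mu> \<nu> \<U> in auto)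
qed

section \<open>Markov kernels: measurability, second moments, vanishing transport cost\<close>

lemma markov_kernelD:
  assumes "markov_kernel K"
  shows "K \<in> borel \<rightarrow>\<^sub>M subprob_algebra borel" "prob_space (K x)" "sets (K x) = sets borel"
  using assms measurable_space[of K borel "prob_algebra borel" x]
  by (auto simp: markov_kernel_def space_prob_algebra intro: measurable_prob_algebraD)

lemma measurable_kernel_apply:
  assumes "markov_kernel K" "f \<in> borel_measurable borel"
  shows "kernel_apply K f \<in> borel_measurable borel"
  unfolding kernel_apply_def
  by (rule measurable_compose[OF markov_kernelD(1)[OF assms(1)]
        integral_measurable_subprob_algebra[OF assms(2)]])

lemma measurable_l2_norm_kernel:
  assumes "markov_kernel K"
  shows "(\<lambda>x. l2_norm (K x)) \<in> borel_measurable borel"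
  unfolding l2_norm_def
  by (intro ennreal_sqrt_measurable measurable_compose[OF markov_kernelD(1)[OF assms]
        nn_integral_measurable_subprob_algebra]) measurable

lemma l2_norm_bind:
  assumes "markov_kernel K" "sets \<mu> = sets borel"
  shows "l2_norm (\<mu> \<bind> K) = ennreal_sqrt (\<integral>\<^sup>+x. (l2_norm (K x))\<^sup>2 \<partial>\<mu>)"
  using markov_kernelD(1)[OF assms(1)]
  by (simp add: l2_norm_def nn_integral_bind[where B = borel] measurable_cong_sets[OF assms(2) refl])

text \<open>Serves the degenerate case in which the Wasserstein factor is 0 while a moment is
  infinite. Each bump gives a measurable function of \<open>x\<close> below
  \<open>W2 (P x) (Q x)\<close>, so it vanishes almost everywhere; countably many bumps identify the
  rows.\<close>

lemma AE_eq_if_nn_integral_W2_eq_0: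
  assumes P: "markov_kernel P" and Q: "markov_kernel Q" and \<mu>: "sets \<mu> = sets borel"
    and 0: "(\<integral>\<^sup>+x. (W2 (P x) (Q x))\<^sup>2 \<partial>\<mu>) = 0"
  shows "AE x in \<mu>. P x = Q x"
proof -
  obtain \<U> :: "'a set set" where \<U>: "countable \<U>" "Int_stable \<U>" "UNIV \<in> \<U>"
    "\<And>U. U \<in> \<U> \<Longrightarrow> open U" "sets borel = sigma_sets UNIV \<U>"
    using ex_countable_Int_stable_open_generator by blast
  note [measurable_cong] = \<mu>
  have "AE x in \<mu>. kernel_apply P (bump U n) x = kernel_apply Q (bump U n) x" for U n
  proof -
    note [measurable] = measurable_kernel_apply[OF P bump_measurable]
      measurable_kernel_apply[OF Q bump_measurable]
    let ?h = "\<lambda>x. ennreal \<bar>kernel_apply P (bump U n) x - kernel_apply Q (bump U n) x\<bar> /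
      ennreal (real n + 1)"
    have "?h x \<le> W2 (P x) (Q x)" for x
    proof -
      have "integrable (P x) (bump U n)" "integrable (Q x) (bump U n)"
        using markov_kernelD(2,3)[OF P] markov_kernelD(2,3)[OF Q]
        by (auto intro!: integrable_bump prob_space.finite_measure)
      \<comment> \<open>The bump is Lipschitz, so \<open>k = 0\<close> works and no moment enters
        (\<open>0 * \<top> = 0\<close>). The constant is \<open>n + 1\<close>, not \<open>n\<close>,
        since \<open>integral_diff_le_W2\<close> requires it to be positive even for
        \<open>n = 0\<close>.\<close>
      moreover have "\<bar>bump U n a - bump U n b\<bar> \<le> norm (a - b) * (0 * norm a + 0 * norm b + (real n + 1))"
        for a b
        using bump_Lipschitz[of U n a b] norm_ge_zero[of "a - b"]
        by (simp add: dist_norm algebra_simps del: norm_ge_zero)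
      ultimately have "ennreal \<bar>kernel_apply P (bump U n) x - kernel_apply Q (bump U n) x\<bar> /
          (ennreal 0 * l2_norm (P x) + ennreal 0 * l2_norm (Q x) + ennreal (real n + 1)) \<le> W2 (P x) (Q x)"
        unfolding kernel_apply_def
        by (intro integral_diff_le_W2 markov_kernelD(2,3)[OF P] markov_kernelD(2,3)[OF Q]) auto
      then show ?thesis by simp
    qed
    \<comment> \<open>Monotonicity of the nonnegative integral requires no measurability of
      \<open>W2\<close>; only \<open>?h\<close> must be measurable, for the conclusion that it is 0
      almost everywhere.\<close>
    then have "(\<integral>\<^sup>+x. (?h x)\<^sup>2 \<partial>\<mu>) \<le> (\<integral>\<^sup>+x. (W2 (P x) (Q x))\<^sup>2 \<partial>\<mu>)"
      by (intro nn_integral_mono power_mono_ennreal)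
    then have "(\<integral>\<^sup>+x. (?h x)\<^sup>2 \<partial>\<mu>) = 0" using 0 by simp
    then have "AE x in \<mu>. (?h x)\<^sup>2 = 0"
      by (subst (asm) nn_integral_0_iff_AE) measurable
    then show ?thesis by eventually_elim (simp add: power2_eq_square)
  qed
  then have "AE x in \<mu>. \<forall>U\<in>\<U>. \<forall>n. kernel_apply P (bump U n) x = kernel_apply Q (bump U n) x"
    using \<U>(1) by (simp add: AE_ball_countable AE_all_countable)
  then show ?thesis
  proof eventually_elim
    case (elim x)
    then show ?case
      by (intro measure_eqI_bump[OF markov_kernelD(2,3)[OF P] markov_kernelD(2,3)[OF Q] \<U>(2-5)])
        (auto simp: kernel_apply_def)
  qed
qed

section \<open>The estimate for one fixed density\<close>

lemma linear_growth_ln_increment_le: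
  assumes "linear_growth c1 c2 v" "0 \<le> c1"
  shows "\<bar>ln (v a) - ln (v b)\<bar> \<le> norm (a - b) * (c1 / 2 * norm a + c1 / 2 * norm b + c2)"
proof (rule gradient_growth_imp_increment_le)
  fix x
  have "0 < v x" "v differentiable (at x)" using assms(1) by (auto simp: linear_growth_def)
  then show "(\<lambda>y. ln (v y)) differentiable (at x)"
    unfolding differentiable_def by (blast intro: has_derivative_ln)
  show "norm (gradient (\<lambda>y. ln (v y)) x) \<le> c1 * norm x + c2"
    using assms(1) by (auto simp: linear_growth_def)
qed fact

text \<open>\<open>ennreal\<close> truncates a negative \<open>r\<close> to 0, but then
  \<open>ereal r\<close> lies below every nonnegative value anyway.\<close>

lemma ereal_le_enn2ereal: "ennreal r \<le> s \<Longrightarrow> ereal r \<le> enn2ereal s"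
  using ennreal_le_iff2
  by (cases s) (auto simp: ennreal_le_iff2 enn2ereal_ennreal)

context
  fixes P Q :: "'a::euclidean_space \<Rightarrow> 'a measure" and \<pi> :: "'a measure"
    and v :: "'a \<Rightarrow> real" and c1 c2 :: real
  assumes P: "markov_kernel P" and Q: "markov_kernel Q"
    and sets_\<pi>: "sets \<pi> = sets borel"
    and v_meas: "v \<in> borel_measurable borel"
    and prob: "prob_space (density \<pi> v)"
    and c: "0 < c1" "0 < c2" "linear_growth c1 c2 v"
begin

private abbreviation (input) "\<rho> \<equiv> density \<pi> v"
private definition "h x = kernel_apply Q (\<lambda>y. ln (v y)) x - kernel_apply P (\<lambda>y. ln (v y)) x" for x
text \<open>The factor that accompanies \<open>W2 (P x) (Q x)\<close> in the bound for
  \<open>h x\<close>; the summand \<open>c2 > 0\<close> keeps it away from 0.\<close>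

private definition "D x = ennreal (c1 / 2) * l2_norm (P x) + ennreal (c1 / 2) * l2_norm (Q x) + ennreal c2" for x

private lemma v_pos: "0 < v x"
  using c by (simp add: linear_growth_def)

private lemma sets_\<rho>: "sets \<rho> = sets borel"
  by (simp add: sets_\<pi>)

private lemma ln_v_meas: "(\<lambda>y. ln (v y)) \<in> borel_measurable borel"
  using v_meas by measurable

private lemma h_meas: "h \<in> borel_measurable borel"
  unfolding h_def
  by (intro borel_measurable_diff measurable_kernel_apply P Q ln_v_meas)

text \<open>The density is positive everywhere, so \<open>\<rho>\<close> and \<open>\<pi>\<close>
  have the same null sets.\<close>

private lemma AE_\<rho>_iff: "(AE x in \<rho>. R x) \<longleftrightarrow> (AE x in \<pi>. R x)"
  using v_meas by (simp add: AE_density v_pos measurable_cong_sets[OF sets_\<pi> refl])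

private lemma integrable_ln:
  assumes "prob_space \<mu>" "sets \<mu> = sets borel" "l2_norm \<mu> < \<infinity>"
  shows "integrable \<mu> (\<lambda>y. ln (v y))"
  by (rule integrable_quadratic_growth[OF assms ln_v_meas, of "c1 / 2" c2])
    (use c linear_growth_ln_increment_le[OF c(3)] in auto)

private lemma expansion_term_eq: "expansion_term \<pi> P Q v = (\<integral>x. h x \<partial>\<rho>)"
  using h_meas v_meas v_pos
  by (subst integral_density)
    (auto simp: expansion_term_def h_def[abs_def] less_imp_le measurable_cong_sets[OF sets_\<pi> refl])

text \<open>The second moment of \<open>\<rho> \<bind> K\<close> is the
  \<open>\<rho>\<close>-average of those of the rows, so almost every row has a finite one and
  integrates \<open>ln v\<close>. So does \<open>\<rho> \<bind> K\<close> itself, and averaging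
  \<open>\<bar>K (ln v)\<bar> \<le> K \<bar>ln v\<bar>\<close> gives the last claim.\<close>

private lemma finite_moments:
  assumes "markov_kernel K" and "l2_norm (\<rho> \<bind> K) < \<infinity>"
  shows "AE x in \<rho>. l2_norm (K x) < \<infinity>"
    and "AE x in \<rho>. integrable (K x) (\<lambda>y. ln (v y))"
    and "integrable \<rho> (kernel_apply K (\<lambda>y. ln (v y)))"
proof -
  interpret prob_space \<rho> by (rule prob)
  note [measurable_cong] = sets_\<rho>
  note [measurable] = measurable_l2_norm_kernel[OF assms(1)] measurable_kernel_apply[OF assms(1) ln_v_meas]
    ln_v_meas
  have "(\<integral>\<^sup>+x. (l2_norm (K x))\<^sup>2 \<partial>\<rho>) \<noteq> \<infinity>"
    using assms(2) by (simp add: l2_norm_bind[OF assms(1) sets_\<rho>] less_top[symmetric])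
  then have "AE x in \<rho>. (l2_norm (K x))\<^sup>2 \<noteq> \<infinity>"
    by (intro nn_integral_PInf_AE) measurable
  then show fin: "AE x in \<rho>. l2_norm (K x) < \<infinity>"
    by eventually_elim (simp add: power_eq_top_ennreal less_top)
  then show int: "AE x in \<rho>. integrable (K x) (\<lambda>y. ln (v y))"
    by eventually_elim (intro integrable_ln markov_kernelD[OF assms(1)])
  have K: "K \<in> \<rho> \<rightarrow>\<^sub>M subprob_algebra borel"
    using markov_kernelD(1)[OF assms(1)] measurable_cong_sets[OF sets_\<rho> refl] by blast
  have "prob_space (\<rho> \<bind> K)"
    by (intro prob_space_bind[OF _ K] AE_I2 markov_kernelD(2)[OF assms(1)])
  moreover have "sets (\<rho> \<bind> K) = sets borel"
    by (intro sets_bind_measurable[OF K] not_empty)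
  ultimately have "integrable (\<rho> \<bind> K) (\<lambda>y. ln (v y))"
    using assms(2) by (rule integrable_ln)
  then have "(\<integral>\<^sup>+y. ennreal (norm (ln (v y))) \<partial>(\<rho> \<bind> K)) < \<infinity>"
    by (simp add: integrable_iff_bounded)
  then have bd: "(\<integral>\<^sup>+x. \<integral>\<^sup>+y. ennreal (norm (ln (v y))) \<partial>K x \<partial>\<rho>) < \<infinity>"
    by (subst (asm) nn_integral_bind[OF _ K]) measurable
  show "integrable \<rho> (kernel_apply K (\<lambda>y. ln (v y)))"
  proof (rule integrableI_bounded)
    have "AE x in \<rho>. ennreal (norm (kernel_apply K (\<lambda>y. ln (v y)) x)) \<le>
        (\<integral>\<^sup>+y. ennreal (norm (ln (v y))) \<partial>K x)"
      using int unfolding kernel_apply_def by eventually_elim (rule integral_norm_bound_ennreal)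
    then have "(\<integral>\<^sup>+x. ennreal (norm (kernel_apply K (\<lambda>y. ln (v y)) x)) \<partial>\<rho>) \<le>
        (\<integral>\<^sup>+x. \<integral>\<^sup>+y. ennreal (norm (ln (v y))) \<partial>K x \<partial>\<rho>)"
      by (rule nn_integral_mono_AE)
    with bd show "(\<integral>\<^sup>+x. ennreal (norm (kernel_apply K (\<lambda>y. ln (v y)) x)) \<partial>\<rho>) < \<infinity>"
      by (rule le_less_trans[rotated])
  qed measurable
qed

lemma expansion_term_definedI:
  assumes "l2_norm (\<rho> \<bind> P) < \<infinity>" "l2_norm (\<rho> \<bind> Q) < \<infinity>"
  shows "expansion_term_defined \<pi> P Q v"
proof -
  have "integrable \<rho> h"
    unfolding h_def[abs_def] by (intro Bochner_Integration.integrable_diff finite_moments P Q assms)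
  then have "integrable \<pi> (\<lambda>x. v x * h x)"
    using h_meas v_meas v_pos
    by (subst (asm) integrable_density)
      (auto simp: less_imp_le measurable_cong_sets[OF sets_\<pi> refl])
  moreover have "AE x in \<pi>. integrable (P x) (\<lambda>y. ln (v y)) \<and> integrable (Q x) (\<lambda>y. ln (v y))"
    using finite_moments(2)[OF P assms(1)] finite_moments(2)[OF Q assms(2)]
    by (simp add: AE_\<rho>_iff)
  ultimately show ?thesis
    unfolding expansion_term_defined_def h_def by simp
qed

private lemma h_div_D_le_W2: "ennreal \<bar>h x\<bar> / D x \<le> W2 (P x) (Q x)"
proof (cases "D x = \<top>")
  case True
  then show ?thesis by (simp only: ennreal_divide_top zero_le)
next
  case False
  \<comment> \<open>As \<open>c1 / 2\<close> is positive, a finite \<open>D x\<close> forces both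
    row moments to be finite.\<close>
  then have "l2_norm (P x) < \<infinity>" "l2_norm (Q x) < \<infinity>"
    using c by (auto simp: D_def ennreal_mult_eq_top_iff less_top[symmetric])
  then have "integrable (P x) (\<lambda>y. ln (v y))" "integrable (Q x) (\<lambda>y. ln (v y))"
    by (auto intro!: integrable_ln markov_kernelD P Q)
  then have "ennreal \<bar>(\<integral>y. ln (v y) \<partial>P x) - (\<integral>y. ln (v y) \<partial>Q x)\<bar> / D x \<le> W2 (P x) (Q x)"
    unfolding D_def using c
    by (intro integral_diff_le_W2 markov_kernelD P Q linear_growth_ln_increment_le) auto
  then show ?thesis
    by (simp add: h_def kernel_apply_def abs_minus_commute)
qed

private lemma expansion_term_le_finite:
  assumes "l2_norm (\<rho> \<bind> P) < \<infinity>" "l2_norm (\<rho> \<bind> Q) < \<infinity>"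
  shows "ennreal (expansion_term \<pi> P Q v) \<le> ennreal_sqrt (\<integral>\<^sup>+x. (W2 (P x) (Q x))\<^sup>2 \<partial>\<rho>) *
    (ennreal (c1 / 2) * l2_norm (\<rho> \<bind> P) + ennreal (c1 / 2) * l2_norm (\<rho> \<bind> Q) + ennreal c2)"
    (is "_ \<le> _ * ?C")
proof -
  note [measurable_cong] = sets_\<rho>
  note [measurable] = measurable_l2_norm_kernel[OF P] measurable_l2_norm_kernel[OF Q] h_meas
  have [measurable]: "D \<in> borel_measurable borel" unfolding D_def[abs_def] by measurable
  have int: "integrable \<rho> h"
    unfolding h_def[abs_def] by (intro Bochner_Integration.integrable_diff finite_moments P Q assms)
  have "(\<integral>x. h x \<partial>\<rho>) \<le> norm (\<integral>x. h x \<partial>\<rho>)" by simp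
  then have "ennreal (expansion_term \<pi> P Q v) \<le> ennreal (norm (\<integral>x. h x \<partial>\<rho>))"
    unfolding expansion_term_eq by (rule ennreal_leI)
  also have "\<dots> \<le> (\<integral>\<^sup>+x. ennreal \<bar>h x\<bar> \<partial>\<rho>)"
    using integral_norm_bound_ennreal[OF int] by simp
  \<comment> \<open>Splitting off \<open>D x\<close> leaves a measurable quotient below
    \<open>W2\<close>, to which Cauchy-Schwarz applies. The split is legitimate where
    \<open>D x\<close> is neither 0 nor infinite, hence almost everywhere.\<close>
  also have "\<dots> = (\<integral>\<^sup>+x. ennreal \<bar>h x\<bar> / D x * D x \<partial>\<rho>)"
  proof (rule nn_integral_cong_AE)
    show "AE x in \<rho>. ennreal \<bar>h x\<bar> = ennreal \<bar>h x\<bar> / D x * D x"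
      using finite_moments(1)[OF P assms(1)] finite_moments(1)[OF Q assms(2)]
    proof eventually_elim
      case (elim x)
      then have "D x \<noteq> 0" "D x \<noteq> \<top>"
        using c by (auto simp: D_def ennreal_mult_eq_top_iff)
      then show ?case by (simp add: ennreal_divide_times ennreal_divide_self less_top)
    qed
  qed
  also have "\<dots> \<le> ennreal_sqrt (\<integral>\<^sup>+x. (ennreal \<bar>h x\<bar> / D x)\<^sup>2 \<partial>\<rho>) * ?C"
    unfolding l2_norm_bind[OF P sets_\<rho>] l2_norm_bind[OF Q sets_\<rho>]
    \<comment> \<open>Only the second \<open>D x\<close> is expanded; the quotient stays whole as
      the function \<open>p\<close>. The row moments play \<open>a\<close> and \<open>b\<close>, and
      their squares integrate to the squared moments of the mixtures.\<close>
    by (subst (2) D_def, intro Cauchy_Schwarz_affine prob) measurable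
  also have "\<dots> \<le> ennreal_sqrt (\<integral>\<^sup>+x. (W2 (P x) (Q x))\<^sup>2 \<partial>\<rho>) * ?C"
    by (intro mult_right_mono ennreal_sqrt_mono nn_integral_mono power_mono_ennreal h_div_D_le_W2) simp
  finally show ?thesis .
qed

text \<open>If a moment is infinite, the right-hand side is infinite unless the Wasserstein factor
  vanishes, in which case it is \<open>0 * \<infinity> = 0\<close> and the two kernels agree almost everywhere.\<close>

lemma expansion_term_le:
  "ennreal (expansion_term \<pi> P Q v) \<le> ennreal_sqrt (\<integral>\<^sup>+x. (W2 (P x) (Q x))\<^sup>2 \<partial>\<rho>) *
    (ennreal (c1 / 2) * l2_norm (\<rho> \<bind> P) + ennreal (c1 / 2) * l2_norm (\<rho> \<bind> Q) + ennreal c2)"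
    (is "_ \<le> ennreal_sqrt ?I * ?C")
proof -
  consider "l2_norm (\<rho> \<bind> P) < \<infinity>" "l2_norm (\<rho> \<bind> Q) < \<infinity>" | "?I = 0" | "?C = \<top>" "?I \<noteq> 0"
    \<comment> \<open>An infinite moment makes \<open>?C\<close> infinite because its coefficient
      \<open>c1 / 2\<close> is positive.\<close>
    using c by (cases "l2_norm (\<rho> \<bind> P) = \<top>"; cases "l2_norm (\<rho> \<bind> Q) = \<top>")
      (auto simp: ennreal_mult_eq_top_iff less_top[symmetric])
  then show ?thesis
  proof cases
    case 1
    then show ?thesis by (rule expansion_term_le_finite)
  next
    case 2
    have "AE x in \<rho>. h x = 0"
      using AE_eq_if_nn_integral_W2_eq_0[OF P Q sets_\<rho> 2]
      by eventually_elim (simp add: h_def kernel_apply_def)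
    then have "expansion_term \<pi> P Q v = 0"
      unfolding expansion_term_eq by (rule integral_eq_zero_AE)
    then show ?thesis by simp
  next
    case 3
    then show ?thesis by (simp only: ennreal_mult_top ennreal_sqrt_eq_0_iff if_False top_greatest)
  qed
qed

end

section \<open>Application to the Poisson-subordinated chain\<close>

text \<open>The left side may be negative and the right side infinite, hence the comparison in
  \<open>ereal\<close>. The first conjunct ensures that, under finite moments, the expansion term is
  a genuine integral and not the default value 0.\<close>

theorem proposition16:
  fixes M :: "'w measure" and Z :: "'z measure" and n :: nat
    and X :: "(nat \<Rightarrow> 'z) \<Rightarrow> nat \<Rightarrow> 'w \<Rightarrow> real ^ 'd"
    and N :: "real \<Rightarrow> 'w \<Rightarrow> nat"
    and PS :: "(nat \<Rightarrow> 'z) \<Rightarrow> real ^ 'd \<Rightarrow> (real ^ 'd) measure"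
    and P :: "real ^ 'd \<Rightarrow> (real ^ 'd) measure"
    and \<mu>\<^sub>0 \<pi> :: "(real ^ 'd) measure"
    and \<rho> :: "real \<Rightarrow> (real ^ 'd) measure"
    and v :: "real \<Rightarrow> real ^ 'd \<Rightarrow> real"
    and c1 c2 :: "real \<Rightarrow> real"
    and S :: "nat \<Rightarrow> 'z" and T :: real
  assumes "prob_space M"
    and "\<And>S. S \<in> space (Pi\<^sub>M {..<n} (\<lambda>_. Z)) \<Longrightarrow> markov_kernel (PS S)"
    and "\<And>S. S \<in> space (Pi\<^sub>M {..<n} (\<lambda>_. Z)) \<Longrightarrow> markov_chain M (PS S) \<mu>\<^sub>0 (X S)"
    and "poisson_process M 1 N"
    and "\<And>S. S \<in> space (Pi\<^sub>M {..<n} (\<lambda>_. Z)) \<Longrightarrow> indep_processes M (X S) N"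
    and "markov_kernel P"
    and "prob_space \<pi>" and "sets \<pi> = sets borel" and "\<pi> \<bind> P = \<pi>"
    and "prob_space \<mu>\<^sub>0" and "sets \<mu>\<^sub>0 = sets borel" and "absolutely_continuous \<pi> \<mu>\<^sub>0"
    and "T > 0" and "S \<in> space (Pi\<^sub>M {..<n} (\<lambda>_. Z))"
    and "\<And>t. t \<ge> 0 \<Longrightarrow> \<rho> t = distr M borel (subordinated (X S) N t)"
    and "\<And>t. t \<in> {0..T} \<Longrightarrow> v t \<in> borel_measurable borel"
    and "\<And>t. t \<in> {0..T} \<Longrightarrow> density \<pi> (\<lambda>x. ennreal (v t x)) = \<rho> t"
    and "\<And>t. t \<in> {0..T} \<Longrightarrow> c1 t > 0 \<and> c2 t > 0 \<and> linear_growth (c1 t) (c2 t) (v t)"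
  shows "\<forall>t\<in>{0..T}.
    (l2_norm (\<rho> t \<bind> P) < \<infinity> \<and> l2_norm (\<rho> t \<bind> PS S) < \<infinity> \<longrightarrow>
       expansion_term_defined \<pi> P (PS S) (v t)) \<and>
    ereal (expansion_term \<pi> P (PS S) (v t)) \<le> enn2ereal
      (ennreal_sqrt (\<integral>\<^sup>+ y. (W2 (P y) (PS S y))\<^sup>2 \<partial>\<rho> t) *
       (ennreal (c1 t / 2) * l2_norm (\<rho> t \<bind> P) +
        ennreal (c1 t / 2) * l2_norm (\<rho> t \<bind> PS S) + ennreal (c2 t)))"
proof (intro ballI conjI impI)
  fix t assume t: "t \<in> {0..T}"
  then have "t \<ge> 0" by simp
  interpret prob_space M by fact
  note S = \<open>S \<in> space (Pi\<^sub>M {..<n} (\<lambda>_. Z))\<close>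
  have "X S k \<in> borel_measurable M" for k
    using assms(3)[OF S] by (simp add: markov_chain_def)
  moreover have "N t \<in> M \<rightarrow>\<^sub>M count_space UNIV"
    using assms(4) \<open>t \<ge> 0\<close> by (simp add: poisson_process_def)
  \<comment> \<open>\<open>N t\<close> takes countably many values, and on each of the corresponding
    events the process is some \<open>X S k\<close>. Measurability makes \<open>\<rho> t\<close> a
    probability law.\<close>
  ultimately have "subordinated (X S) N t \<in> borel_measurable M"
    unfolding subordinated_def[abs_def] by (rule measurable_compose_countable)
  then have "prob_space (density \<pi> (v t))"
    unfolding assms(17)[OF t] assms(15)[OF \<open>t \<ge> 0\<close>] by (rule prob_space_distr)
  note hyps = \<open>markov_kernel P\<close> assms(2)[OF S] \<open>sets \<pi> = sets borel\<close> assms(16)[OF t] this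
  note c = assms(18)[OF t]
  show "expansion_term_defined \<pi> P (PS S) (v t)"
    if "l2_norm (\<rho> t \<bind> P) < \<infinity> \<and> l2_norm (\<rho> t \<bind> PS S) < \<infinity>"
    using that c unfolding assms(17)[OF t, symmetric]
    by (intro expansion_term_definedI[OF hyps, of "c1 t" "c2 t"]) auto
  show "ereal (expansion_term \<pi> P (PS S) (v t)) \<le> enn2ereal
      (ennreal_sqrt (\<integral>\<^sup>+ y. (W2 (P y) (PS S y))\<^sup>2 \<partial>\<rho> t) *
       (ennreal (c1 t / 2) * l2_norm (\<rho> t \<bind> P) +
        ennreal (c1 t / 2) * l2_norm (\<rho> t \<bind> PS S) + ennreal (c2 t)))"
    using c unfolding assms(17)[OF t, symmetric]
    by (intro ereal_le_enn2ereal expansion_term_le[OF hyps]) auto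
qed

end
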